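(* Let $d\geq 2$ be a squarefree integer, let $K=\mathbb{Q}(\sqrt{d})$ with ring of integers $\mathcal{O}_K$, let $\sigma_1,\sigma_2\colon K\hookrightarrow\mathbb{R}$ be the two real embeddings of $K$, and let $\Delta_K$ be the absolute discriminant of $K$. Let $\nu\in\mathbb{Z}_{>0}$ and $t,q,x\in\mathcal{O}_K$ satisfy $$q^2\in\mathbb{Q}\quad\text{and}\quad q=t+\nu x.$$ Suppose further that $$\nu\nmid\operatorname{Tr}_{K/\mathbb{Q}}(t)\text{ in }\mathbb{Z}\quad\text{and}\quad|\sigma_1(t)-\sigma_2(t)|<\nu\sqrt{\Delta_K}.$$ Then $t\in\mathbb{Z}$.
   Context: $\operatorname{Tr}_{K/\mathbb{Q}}$ is the field trace. $\Delta_K=d$ if $d\equiv 1\pmod 4$ and $\Delta_K=4d$ otherwise. *)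

theory Defs
  imports Complex_Main "HOL-Computational_Algebra.Computational_Algebra" "HOL-Number_Theory.Cong"
begin

text \<open>Number fields are subfields of \<^typ>\<open>real\<close>, given by their carrier sets.\<close>

definition real_subfield :: "real set \<Rightarrow> bool" where
  "real_subfield F \<longleftrightarrow> 0 \<in> F \<and> 1 \<in> F \<and>
     (\<forall>x\<in>F. \<forall>y\<in>F. x + y \<in> F \<and> x * y \<in> F) \<and>
     (\<forall>x\<in>F. - x \<in> F \<and> inverse x \<in> F)"

text \<open>The field obtained by adjoining the square root of \<open>d\<close> to the rationals; the prime field
  lies in every subfield, so it need not be mentioned.\<close>

definition quadratic_field :: "int \<Rightarrow> real set" where
  "quadratic_field d = real_subfield hull {sqrt (of_int d)}"

definition ring_of_integers :: "real set \<Rightarrow> real set" where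
  "ring_of_integers K = {x \<in> K. algebraic_int x}"

text \<open>Only the values on \<open>K\<close> matter; injectivity is automatic for a unital homomorphism of
  fields.\<close>

definition real_embedding :: "real set \<Rightarrow> (real \<Rightarrow> real) \<Rightarrow> bool" where
  "real_embedding K s \<longleftrightarrow> s 1 = 1 \<and>
     (\<forall>x\<in>K. \<forall>y\<in>K. s (x + y) = s x + s y \<and> s (x * y) = s x * s y)"

global_interpretation rat_vs: vector_space "\<lambda>(r::rat) (x::real). of_rat r * x"
  by unfold_locales (simp_all add: algebra_simps of_rat_add of_rat_mult)

definition rat_basis :: "real set \<Rightarrow> real set \<Rightarrow> bool" where
  "rat_basis K B \<longleftrightarrow> rat_vs.independent B \<and> rat_vs.span B = K"

text \<open>The trace of the endomorphism \<open>x \<mapsto> a * x\<close> of the rational vector space \<open>K\<close>: the sum of the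
  diagonal entries of its matrix in a basis of \<open>K\<close>. It does not depend on the chosen basis.
  It is meant for \<open>K\<close> of finite degree and \<open>a \<in> K\<close>.\<close>

definition field_trace :: "real set \<Rightarrow> real \<Rightarrow> rat" where
  "field_trace K a =
     (let B = (SOME B. rat_basis K B) in \<Sum>b\<in>B. rat_vs.representation B (a * b) b)"

definition quadratic_discriminant :: "int \<Rightarrow> int" where
  "quadratic_discriminant d = (if [d = 1] (mod 4) then d else 4 * d)"

end

theory Submission
  imports Defs
begin

text \<open>
  As \<open>q\<^sup>2\<close> is rational, \<open>q\<close> is either rational or a rational multiple of \<open>\<surd>d\<close>. In the second case
  \<open>q\<close> has trace \<open>0\<close>, so \<open>Tr t = - \<nu> Tr x\<close> is divisible by \<open>\<nu>\<close>, which is excluded. In the first case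
  \<open>\<bar>\<sigma>\<^sub>1 t - \<sigma>\<^sub>2 t\<bar> = \<nu> \<bar>\<sigma>\<^sub>1 x - \<sigma>\<^sub>2 x\<bar>\<close>, so the two conjugates of \<open>x\<close> differ by less than \<open>\<surd>\<Delta>\<close>;
  this is the smallest nonzero distance between conjugates of an integer of the field, hence \<open>x\<close>,
  and with it \<open>t\<close>, is rational.
\<close>

section \<open>Integrality of the coefficients of a quadratic equation\<close>

lemma map_poly_of_int_add:
  "map_poly of_int (p + q) = map_poly of_int p + (map_poly of_int q :: 'a::ring_char_0 poly)"
  by (intro poly_eqI) (simp add: coeff_map_poly)

lemma map_poly_of_int_mult:
  "map_poly of_int (p * q) = map_poly of_int p * (map_poly of_int q :: 'a::{comm_ring_1,ring_char_0} poly)"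
  by (intro poly_eqI) (simp add: coeff_map_poly coeff_mult)

text \<open>Gauss's lemma: the primitive integral multiple \<open>F\<close> of the minimal polynomial divides some
  \<open>e \<cdot> p\<close> with \<open>p\<close> integral and monic; comparing contents shows that \<open>F\<close> has leading
  coefficient \<open>\<plusminus>1\<close>.\<close>

lemma irrational_quadratic_integer_coeffs:
  fixes a P Q :: real
  assumes a: "algebraic_int a" "a \<notin> \<rat>" and PQ: "P \<in> \<rat>" "Q \<in> \<rat>" and eq: "a\<^sup>2 = P * a - Q"
  shows "P \<in> \<int>" "Q \<in> \<int>"
proof -
  let ?ev = "\<lambda>p::int poly. poly (map_poly of_int p) a"
  obtain i j where ij: "P = of_int i / of_int j" "j > 0"
    using PQ(1) by (elim Rats_cases') auto
  obtain k l where kl: "Q = of_int k / of_int l" "l > 0"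
    using PQ(2) by (elim Rats_cases') auto
  \<comment> \<open>Clearing the denominators of X^2 - P X + Q by the factor \<open>j * l\<close>
    gives an integral polynomial that still vanishes at \<open>a\<close>.\<close>
  define G where "G = [:k * j, - (i * l), j * l:]"
  have G0: "G \<noteq> 0" and degG: "degree G = 2"
    using ij kl by (auto simp: G_def)
  have evG: "?ev G = 0"
  proof -
    have "?ev G = of_int (j * l) * (a\<^sup>2 - P * a + Q)"
      using ij kl by (simp add: G_def map_poly_pCons field_simps power2_eq_square)
    then show ?thesis using eq by simp
  qed
  define F c where "F = primitive_part G" and "c = content G"
  have Gc: "G = smult c F" and c0: "c \<noteq> 0" and F0: "F \<noteq> 0" and cF: "content F = 1"
    and degF: "degree F = 2"
    using G0 degG by (auto simp: F_def c_def)
  have evF: "?ev F = 0"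
    using evG c0 unfolding Gc by (simp add: map_poly_smult)
  obtain p where p: "?ev p = 0" "lead_coeff p = 1"
    using a(1) unfolding algebraic_int_altdef_ipoly by auto
  \<comment> \<open>Pseudo-division stays within integral polynomials at the price of the factor
    \<open>e\<close>. The remainder has degree at most 1 and vanishes at the irrational
    \<open>a\<close>, so it is zero.\<close>
  obtain e q where eq: "e \<noteq> 0" "smult e p = F * q + pseudo_mod p F"
    using pseudo_mod(1)[OF F0] by blast
  define r where "r = pseudo_mod p F"
  have "degree r \<le> 1"
    using pseudo_mod(2)[OF F0, of p] degF by (auto simp: r_def)
  then have rform: "r = [:coeff r 0, coeff r 1:]"
    by (intro poly_eqI) (auto simp: coeff_pCons coeff_eq_0 split: nat.splits)
  have "of_int e * ?ev p = ?ev F * ?ev q + ?ev r"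
    using arg_cong[OF eq(2), of ?ev]
    by (simp add: r_def map_poly_smult map_poly_of_int_add map_poly_of_int_mult)
  then have evr: "?ev r = 0" using p evF by simp
  have "coeff r 1 = 0"
  proof (rule ccontr)
    assume n: "coeff r 1 \<noteq> 0"
    have "of_int (coeff r 0) + a * of_int (coeff r 1) = 0"
      using evr by (subst (asm) rform) (simp add: map_poly_pCons)
    then have "a = - of_int (coeff r 0) / of_int (coeff r 1)"
      using n by (simp add: field_simps)
    then show False using a(2) by simp
  qed
  then have rc: "r = [:coeff r 0:]" using rform by simp
  have "of_int (coeff r 0) = (0::real)"
    using evr by (subst (asm) rc) (simp add: map_poly_pCons)
  then have "r = 0" using rc by simp
  then have ep: "smult e p = F * q" using eq(2) r_def by simp
  have "content p dvd 1"
    using content_dvd_coeff[of p "degree p"] p(2) by simp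
  then have "content p = 1" unfolding is_unit_content_iff .
  \<comment> \<open>Content is multiplicative and both \<open>p\<close> and \<open>F\<close> have
    content 1. Hence \<open>e\<close> divides every coefficient of \<open>q\<close> and can be
    cancelled from the equation of leading coefficients.\<close>
  then have cq: "content q = \<bar>e\<bar>"
    using arg_cong[OF ep, of content] cF by (simp add: content_mult)
  then obtain w where w: "lead_coeff q = e * w"
    using content_dvd_coeff[of q "degree q"] by (metis abs_dvd_iff dvdE)
  have "e * 1 = e * (lead_coeff F * w)"
    using arg_cong[OF ep, of lead_coeff] by (simp only: lead_coeff_smult lead_coeff_mult p(2) w ac_simps)
  then have "lead_coeff F dvd 1"
    using eq(1) by (metis dvd_triv_left mult_cancel_left)
  then have lF: "coeff F 2 = 1 \<or> coeff F 2 = - 1"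
    using degF by (auto simp: zdvd1_eq)
  have co: "k * j = c * coeff F 0" "- (i * l) = c * coeff F 1" "j * l = c * coeff F 2"
    using arg_cong[OF Gc, of "\<lambda>p. coeff p 0"] arg_cong[OF Gc, of "\<lambda>p. coeff p 1"]
      arg_cong[OF Gc, of "\<lambda>p. coeff p 2"]
    by (simp_all add: G_def numeral_2_eq_2)
  have "P = of_int (i * l) / of_int (j * l)" "Q = of_int (k * j) / of_int (j * l)"
    using ij kl by simp_all
  moreover have "i * l = - (c * coeff F 1)" using co(2) by simp
  ultimately have "P = - of_int (coeff F 1) / of_int (coeff F 2)"
    "Q = of_int (coeff F 0) / of_int (coeff F 2)"
    using c0 by (simp_all only: co(1,3)) simp_all
  then show "P \<in> \<int>" "Q \<in> \<int>" using lF by auto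
qed

section \<open>Squarefree radicands\<close>

text \<open>With \<open>s\<close> in lowest terms, the square of its denominator has to divide
  \<open>d\<close>, so the denominator is 1.\<close>

lemma rational_square_times_squarefree:
  fixes s :: real and d :: int
  assumes "squarefree d" "s \<in> \<rat>" "s\<^sup>2 * of_int d \<in> \<int>"
  shows "s \<in> \<int>"
proof -
  obtain u v where uv: "s = of_int u / of_int v" "v > 0" "coprime u v"
    using assms(2) by (elim Rats_cases') auto
  obtain n where n: "s\<^sup>2 * of_int d = of_int n"
    using assms(3) by (elim Ints_cases)
  have "of_int (u\<^sup>2 * d) = (of_int (n * v\<^sup>2) :: real)"
    using n uv by (simp add: field_simps)
  then have "u\<^sup>2 * d = n * v\<^sup>2" unfolding of_int_eq_iff .
  then have "v\<^sup>2 dvd u\<^sup>2 * d" by simp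
  moreover have "coprime (v\<^sup>2) (u\<^sup>2)" using uv(3) by (simp add: coprime_commute)
  ultimately have "v\<^sup>2 dvd d" using coprime_dvd_mult_right_iff by blast
  then have "v dvd 1" using assms(1) squarefreeD by blast
  then have "v = 1" using uv(2) by simp
  then show ?thesis using uv by simp
qed

lemma sqrt_squarefree_irrational:
  fixes d :: int
  assumes "d \<ge> 2" "squarefree d"
  shows "sqrt (of_int d) \<notin> \<rat>"
proof
  \<comment> \<open>The inverse is the useful witness: its square times \<open>d\<close> is 1, so if
    rational it would be an integer strictly between 0 and 1.\<close>
  let ?s = "inverse (sqrt (of_int d))"
  assume "sqrt (of_int d) \<in> \<rat>"
  then have "?s \<in> \<rat>" by (rule Rats_inverse)
  moreover have "?s\<^sup>2 * of_int d = 1" using assms(1) by (simp add: power_inverse)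
  ultimately have "?s \<in> \<int>"
    using rational_square_times_squarefree[OF assms(2)] by simp
  then obtain m where m: "?s = of_int m" by (elim Ints_cases)
  have "1 < sqrt (of_int d)" using assms(1) by simp
  then have "0 < ?s" "?s < 1" using one_less_inverse_iff[of ?s] by simp_all
  then show False unfolding m by simp
qed

section \<open>The field generated by a square root\<close>

text \<open>This is the characteristic equation with trace \<open>2 * p\<close> and norm
  \<open>p\<^sup>2 - r\<^sup>2 * D\<close>, in the shape y^2 = P y - Q that the results on
  coefficients and on the trace expect.\<close>

lemma power2_add_mult_root:
  fixes s D p r :: "'a::comm_ring_1"
  assumes "s * s = D"
  shows "(p + r * s)\<^sup>2 = 2 * p * (p + r * s) - (p\<^sup>2 - r\<^sup>2 * D)"
  by (simp add: assms[symmetric] power2_eq_square algebra_simps)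

lemma irrational_coeff_eq_0:
  fixes s p r :: real
  assumes "s \<notin> \<rat>" "p \<in> \<rat>" "r \<in> \<rat>" "p + r * s \<in> \<rat>"
  shows "r = 0"
proof (rule ccontr)
  assume "r \<noteq> 0"
  then have "s = ((p + r * s) - p) / r" by simp
  also have "\<dots> \<in> \<rat>" using assms by (intro Rats_divide Rats_diff)
  finally show False using assms(1) by simp
qed

lemma Rats_subset_real_subfield:
  assumes "real_subfield F"
  shows "\<rat> \<subseteq> F"
proof
  have F: "0 \<in> F" "1 \<in> F" "\<And>x y. x \<in> F \<Longrightarrow> y \<in> F \<Longrightarrow> x + y \<in> F"
    "\<And>x y. x \<in> F \<Longrightarrow> y \<in> F \<Longrightarrow> x * y \<in> F"
    "\<And>x. x \<in> F \<Longrightarrow> - x \<in> F" "\<And>x. x \<in> F \<Longrightarrow> inverse x \<in> F"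
    using assms by (auto simp: real_subfield_def)
  have nat: "of_nat n \<in> F" for n
    by (induction n) (auto intro: F)
  have int: "of_int i \<in> F" for i
    by (cases i rule: int_cases2) (auto intro: F nat)
  fix x :: real assume "x \<in> \<rat>"
  then obtain i j where "x = of_int i / of_int j"
    by (elim Rats_cases') auto
  then show "x \<in> F"
    using F(4)[OF int[of i] F(6)[OF int[of j]]] by (simp add: divide_inverse)
qed

lemma real_subfield_sqrt:
  assumes d: "d \<ge> 0" "sqrt (of_int d) \<notin> \<rat>"
  shows "real_subfield {p + r * sqrt (of_int d) | p r. p \<in> \<rat> \<and> r \<in> \<rat>}" (is "real_subfield ?R")
proof -
  let ?s = "sqrt (of_int d)"
  have R: "x \<in> ?R" if "x = p + r * ?s" "p \<in> \<rat>" "r \<in> \<rat>" for x p r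
    using that by auto
  have ss: "?s * ?s = of_int d" using d(1) by simp
  have "0 \<in> ?R" by (rule R[of _ 0 0]) auto
  moreover have "1 \<in> ?R" by (rule R[of _ 1 0]) auto
  moreover have "x + y \<in> ?R" "x * y \<in> ?R" if xy: "x \<in> ?R" "y \<in> ?R" for x y
  proof -
    obtain p r p' r' where x: "x = p + r * ?s" "p \<in> \<rat>" "r \<in> \<rat>"
      and y: "y = p' + r' * ?s" "p' \<in> \<rat>" "r' \<in> \<rat>"
      using xy by blast
    have "x + y = (p + p') + (r + r') * ?s"
      using x y by (simp add: algebra_simps)
    moreover have "(p + r * s) * (p' + r' * s) = (p * p' + r * r' * D) + (p * r' + r * p') * s"
      if "s * s = D" for s D :: real
      by (simp add: that[symmetric] algebra_simps)
    then have "x * y = (p * p' + r * r' * of_int d) + (p * r' + r * p') * ?s"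
      using x(1) y(1) ss by metis
    ultimately show "x + y \<in> ?R" "x * y \<in> ?R"
      using x(2,3) y(2,3) by (blast intro: R Rats_add Rats_mult Rats_of_int)+
  qed
  moreover have "- x \<in> ?R" "inverse x \<in> ?R" if xR: "x \<in> ?R" for x
  proof -
    obtain p r where x: "x = p + r * ?s" "p \<in> \<rat>" "r \<in> \<rat>"
      using xR by blast
    \<comment> \<open>\<open>N\<close> is the norm of \<open>x\<close>; inverses come from
      multiplying by the conjugate \<open>p - r * ?s\<close>, which vanishes only for
      \<open>x = 0\<close> because \<open>?s\<close> is irrational.\<close>
    define N where "N = p\<^sup>2 - r\<^sup>2 * of_int d"
    have N: "N \<in> \<rat>" using x by (simp add: N_def)
    have Nx: "N = x * (p - r * ?s)"
      using power2_add_mult_root[OF ss, of p r] by (simp add: N_def x(1) power2_eq_square algebra_simps)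
    \<comment> \<open>For \<open>x = 0\<close> also \<open>N = 0\<close>, and both sides are 0 by
      the convention on division by zero.\<close>
    have "inverse x = p / N + (- r / N) * ?s"
    proof (cases "x = 0")
      case True
      then show ?thesis using Nx by simp
    next
      case False
      have "p - r * ?s \<noteq> 0"
      proof
        assume eq: "p - r * ?s = 0"
        then have "p + (- r) * ?s \<in> \<rat>" by simp
        then have "- r = 0" using x d(2) irrational_coeff_eq_0 Rats_minus_iff by metis
        then show False using eq x False by simp
      qed
      then have "inverse x = (p - r * ?s) / N" 
        unfolding Nx using False by (simp add: nonzero_inverse_eq_divide)
      then show ?thesis by (simp add: diff_divide_distrib)
    qed
    moreover have "- x = - p + (- r) * ?s" using x by simp
    moreover have "- p \<in> \<rat>" "- r \<in> \<rat>" "p / N \<in> \<rat>" "- r / N \<in> \<rat>"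
      using x(2,3) N by simp_all
    ultimately show "- x \<in> ?R" "inverse x \<in> ?R" by (blast intro: R)+
  qed
  ultimately show ?thesis unfolding real_subfield_def by (intro conjI ballI)
qed

text \<open>The explicit set is itself a subfield containing the root, and any other such subfield
  contains it because it contains \<open>\<rat>\<close>.\<close>

lemma quadratic_field_eq:
  assumes d: "d \<ge> 0" "sqrt (of_int d) \<notin> \<rat>"
  shows "quadratic_field d = {p + r * sqrt (of_int d) | p r. p \<in> \<rat> \<and> r \<in> \<rat>}" (is "_ = ?R")
  unfolding quadratic_field_def
proof (rule hull_unique)
  let ?s = "sqrt (of_int d)"
  have "?s = 0 + 1 * ?s" by simp
  then have "?s \<in> ?R" using Rats_0 Rats_1 by blast
  then show "{?s} \<subseteq> ?R" by simp
  show "real_subfield ?R" using d by (rule real_subfield_sqrt)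
  fix F assume F: "{?s} \<subseteq> F" "real_subfield F"
  then show "?R \<subseteq> F"
    using Rats_subset_real_subfield[OF F(2)] by (auto simp: real_subfield_def subset_iff)
qed

text \<open>Additivity and \<open>s 1 = 1\<close> determine the values on integers; multiplicativity
  extends this to quotients.\<close>

lemma real_embedding_Rats:
  assumes F: "real_subfield F" and s: "real_embedding F s" and x: "x \<in> \<rat>"
  shows "s x = x"
proof -
  have Q: "y \<in> F" if "y \<in> \<rat>" for y
    using that Rats_subset_real_subfield[OF F] by auto
  have add: "s (y + z) = s y + s z" and mult: "s (y * z) = s y * s z"
    if "y \<in> \<rat>" "z \<in> \<rat>" for y z
    using s that Q by (auto simp: real_embedding_def)
  have one: "s 1 = 1" using s by (simp add: real_embedding_def)
  have zero: "s 0 = 0" using add[of 0 0] by simp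
  have nat: "s (of_nat n) = of_nat n" for n
    by (induction n) (auto simp: zero one add)
  have minus: "s (- y) = - s y" if "y \<in> \<rat>" for y
    using add[of y "- y"] that zero by simp
  have int: "s (of_int i) = of_int i" for i
    by (cases i rule: int_cases2) (auto simp: nat minus)
  obtain i j where x: "x = of_int i / of_int j" "j > 0"
    using x by (elim Rats_cases') auto
  have "s (x * of_int j) = s x * of_int j"
    using x by (subst mult) (auto simp: int)
  then have "s x * of_int j = x * of_int j" using x int[of i] by simp
  then show ?thesis using x(2) by (simp only: mult_cancel_right) simp
qed

section \<open>Trace, integers and conjugates\<close>

text \<open>\<open>field_trace\<close> is computed in an unspecified basis. The known basis
  \<open>C\<close> shows that this one has two elements as well, so the trace is that of a 2 by 2
  matrix.\<close>

lemma field_trace_quadratic: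
  fixes K C :: "real set" and a P Q :: real
  assumes C: "rat_basis K C" "card C = 2"
    and a: "a \<notin> \<rat>" "\<And>x. x \<in> K \<Longrightarrow> a * x \<in> K"
    and PQ: "P \<in> \<rat>" "Q \<in> \<rat>" "a\<^sup>2 = P * a - Q"
  shows "of_rat (field_trace K a) = P"
proof -
  define B where "B = (SOME B. rat_basis K B)"
  have B: "rat_basis K B" using C(1) unfolding B_def by (rule someI)
  then have ind: "rat_vs.independent B" and span: "rat_vs.span B = K"
    by (auto simp: rat_basis_def)
  \<comment> \<open>Since an infinite set has cardinality 0, equality with \<open>card C\<close>
    also shows that \<open>B\<close> is finite.\<close>
  have "card B = rat_vs.dim K"
    using rat_vs.dim_span_eq_card_independent[OF ind] span by simp
  also have "\<dots> = card C"
    using C rat_vs.dim_span_eq_card_independent[of C] by (auto simp: rat_basis_def)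
  finally obtain u v where uv: "B = {u, v}" "u \<noteq> v"
    using C(2) by (auto simp: card_2_iff)
  let ?m = "\<lambda>b c. of_rat (rat_vs.representation B (a * b) c) :: real"
  have rep: "a * b = ?m b u * u + ?m b v * v" if "b \<in> B" for b
  proof -
    have "a * b \<in> rat_vs.span B"
      using a(2) that span rat_vs.span_base by metis
    then have "(\<Sum>c\<in>B. ?m b c * c) = a * b"
      by (rule rat_vs.sum_representation_eq[OF ind]) (use uv in auto)
    then show ?thesis using uv by simp
  qed
  define \<alpha> \<beta> \<gamma> \<delta> where m: "\<alpha> = ?m u u" "\<beta> = ?m u v" "\<gamma> = ?m v u" "\<delta> = ?m v v"
  have e: "(a - \<alpha>) * u = \<beta> * v" "(a - \<delta>) * v = \<gamma> * u"
    using rep[of u] rep[of v] uv(1) unfolding m by (simp_all add: left_diff_distrib)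
  have "u \<noteq> 0" using ind uv(1) rat_vs.dependent_zero by blast
  \<comment> \<open>\<open>a\<close> is an eigenvalue of its own multiplication matrix, hence a root of the characteristic
    polynomial, which must agree with the minimal polynomial as \<open>a\<close> is irrational.\<close>
  have "(a - \<alpha>) * (a - \<delta>) * u = (a - \<delta>) * ((a - \<alpha>) * u)"
    by (simp only: mult_ac)
  also have "\<dots> = \<beta> * ((a - \<delta>) * v)"
    unfolding e(1) by (simp only: mult_ac)
  also have "\<dots> = \<beta> * \<gamma> * u"
    unfolding e(2) by (simp only: mult_ac)
  finally have "(a - \<alpha>) * (a - \<delta>) = \<beta> * \<gamma>" using \<open>u \<noteq> 0\<close> by simp
  then have "(\<alpha> * \<delta> - \<beta> * \<gamma> - Q) + (P - (\<alpha> + \<delta>)) * a = 0"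
    using PQ(3) by (simp add: algebra_simps power2_eq_square)
  then have "P - (\<alpha> + \<delta>) = 0"
    using PQ m by (intro irrational_coeff_eq_0[OF a(1), of "\<alpha> * \<delta> - \<beta> * \<gamma> - Q"]) simp_all
  moreover have "of_rat (field_trace K a) = \<alpha> + \<delta>"
    unfolding field_trace_def Let_def B_def[symmetric] using uv by (simp add: m of_rat_add)
  ultimately show ?thesis by simp
qed

lemma rat_basis_sqrt:
  assumes d: "d \<ge> 0" "sqrt (of_int d) \<notin> \<rat>"
  shows "rat_basis (quadratic_field d) {1, sqrt (of_int d)}"
proof -
  let ?s = "sqrt (of_int d)"
  have "rat_vs.span {1, ?s} = quadratic_field d"
    unfolding quadratic_field_eq[OF d]
    by (auto simp: rat_vs.span_insert rat_vs.span_empty diff_eq_eq elim!: Rats_cases)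
      (metis Rats_of_rat add.commute)+
  moreover have "?s \<notin> rat_vs.span {1}"
    using d(2) by (auto simp: rat_vs.span_singleton)
  ultimately show ?thesis
    unfolding rat_basis_def
    using rat_vs.independent_insert[of ?s "{1}"] d(2) by (simp add: insert_commute)
qed

text \<open>Trace and norm are integers, hence so is \<open>(2 * r)\<^sup>2 * d\<close>, and
  squarefreeness makes \<open>2 * r\<close> an integer. Were it odd, \<open>d\<close> would be a
  square modulo 4, hence 1, as 0 is ruled out by squarefreeness.\<close>

lemma real_quadratic_algebraic_int:
  fixes d :: int and p r :: real
  assumes d: "d \<ge> 2" "squarefree d" and pr: "p \<in> \<rat>" "r \<in> \<rat>"
    and a: "algebraic_int (p + r * sqrt (of_int d))"
  shows "2 * p \<in> \<int>" "2 * r \<in> \<int>" "\<not> [d = 1] (mod 4) \<Longrightarrow> r \<in> \<int>"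
proof -
  let ?s = "sqrt (of_int d)"
  note irr = sqrt_squarefree_irrational[OF d]
  have ss: "?s * ?s = of_int d" using d(1) by simp
  \<comment> \<open>For \<open>r = 0\<close> the element is rational and so an integer itself; the
    result on quadratic coefficients covers only irrational elements.\<close>
  have *: "2 * p \<in> \<int> \<and> p\<^sup>2 - r\<^sup>2 * of_int d \<in> \<int>"
  proof (cases "r = 0")
    case True
    then have "p \<in> \<int>" using a pr rational_algebraic_int_is_int by simp
    then show ?thesis using True by simp
  next
    case False
    then have "p + r * ?s \<notin> \<rat>" using irrational_coeff_eq_0 irr pr by blast
    moreover have "(p + r * ?s)\<^sup>2 = 2 * p * (p + r * ?s) - (p\<^sup>2 - r\<^sup>2 * of_int d)"
      by (rule power2_add_mult_root[OF ss])
    ultimately show ?thesis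
      using irrational_quadratic_integer_coeffs[OF a, of "2 * p" "p\<^sup>2 - r\<^sup>2 * of_int d"] pr by simp
  qed
  then show "2 * p \<in> \<int>" by simp
  have "(2 * r)\<^sup>2 * of_int d = (2 * p)\<^sup>2 - 4 * (p\<^sup>2 - r\<^sup>2 * of_int d)"
    by (simp add: power2_eq_square algebra_simps)
  moreover have "(2 * p)\<^sup>2 - 4 * (p\<^sup>2 - r\<^sup>2 * of_int d) \<in> \<int>"
    using * by (blast intro: Ints_diff Ints_power Ints_mult Ints_numeral)
  ultimately have "(2 * r)\<^sup>2 * of_int d \<in> \<int>" by (simp only:)
  moreover have "2 * r \<in> \<rat>" using pr by simp
  ultimately show r2: "2 * r \<in> \<int>"
    using rational_square_times_squarefree[OF d(2)] by blast
  assume d1: "\<not> [d = 1] (mod 4)"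
  obtain P where P: "2 * p = of_int P" using * by (auto elim: Ints_cases)
  obtain R where R: "2 * r = of_int R" using r2 by (auto elim: Ints_cases)
  obtain N where N: "p\<^sup>2 - r\<^sup>2 * of_int d = of_int N" using * by (auto elim: Ints_cases)
  have "of_int (P\<^sup>2 - R\<^sup>2 * d) = (2 * p)\<^sup>2 - (2 * r)\<^sup>2 * of_int d"
    by (simp add: P R)
  also have "\<dots> = 4 * (p\<^sup>2 - r\<^sup>2 * of_int d)"
    by (simp add: power2_eq_square algebra_simps)
  also have "\<dots> = of_int (4 * N)" by (simp add: N)
  finally have eq: "P\<^sup>2 - R\<^sup>2 * d = 4 * N" unfolding of_int_eq_iff .
  have "even R"
  proof (rule ccontr)
    assume "odd R"
    then obtain w where w: "R = 2 * w + 1" by (elim oddE)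
    \<comment> \<open>For odd \<open>R\<close> the square \<open>R\<^sup>2\<close> is 1 modulo 4, so
      \<open>eq\<close> reduces to \<open>d\<close> being congruent to
      \<open>P\<^sup>2\<close>.\<close>
    have "d = P\<^sup>2 - 4 * (N + (w\<^sup>2 + w) * d)"
      using eq unfolding w by (simp add: power2_eq_square algebra_simps)
    then have cong: "[d = P\<^sup>2] (mod 4)"
      by (metis cong_iff_lin cong_sym mult.commute add_diff_cancel diff_add_cancel)
    show False
    proof (cases "even P")
      case True
      then obtain y where "P = 2 * y" by (elim evenE)
      then have "2\<^sup>2 dvd d"
        using cong by (simp add: cong_def power_mult_distrib mod_eq_0_iff_dvd)
      then show False using d(2) squarefreeD[of d 2] by auto
    next
      case False
      then obtain y where "P = 2 * y + 1" by (elim oddE)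
      then have "P\<^sup>2 - 1 = 4 * (y\<^sup>2 + y)" by (simp add: power2_eq_square algebra_simps)
      then have "[P\<^sup>2 = 1] (mod 4)" by (simp add: cong_iff_dvd_diff)
      then show False using cong d1 cong_trans by blast
    qed
  qed
  then obtain w where "R = 2 * w" by (elim evenE)
  then have "r = of_int w" using R by simp
  then show "r \<in> \<int>" by simp
qed

text \<open>An embedding fixes \<open>\<rat>\<close> and sends the root to itself or its negative.
  Two embeddings that differ somewhere on the field therefore choose opposite signs.\<close>

lemma real_embedding_diff:
  assumes d: "d \<ge> 0" "sqrt (of_int d) \<notin> \<rat>"
    and s: "real_embedding (quadratic_field d) \<sigma>\<^sub>1" "real_embedding (quadratic_field d) \<sigma>\<^sub>2"
    and ne: "\<exists>z\<in>quadratic_field d. \<sigma>\<^sub>1 z \<noteq> \<sigma>\<^sub>2 z"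
    and pr: "p \<in> \<rat>" "r \<in> \<rat>"
  shows "\<bar>\<sigma>\<^sub>1 (p + r * sqrt (of_int d)) - \<sigma>\<^sub>2 (p + r * sqrt (of_int d))\<bar> = 2 * \<bar>r\<bar> * sqrt (of_int d)"
proof -
  let ?s = "sqrt (of_int d)" and ?K = "quadratic_field d"
  note K = quadratic_field_eq[OF d]
  have sf: "real_subfield ?K" unfolding K by (rule real_subfield_sqrt[OF d])
  have sK: "?s \<in> ?K" using rat_basis_sqrt[OF d] rat_vs.span_base
    unfolding rat_basis_def by blast
  have val: "\<sigma> (p + r * ?s) = p + r * \<sigma> ?s" "\<sigma> ?s = ?s \<or> \<sigma> ?s = - ?s"
    if e: "real_embedding ?K \<sigma>" and "p \<in> \<rat>" "r \<in> \<rat>" for \<sigma> p r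
  proof -
    have pK: "p \<in> ?K" "r \<in> ?K" using that Rats_subset_real_subfield[OF sf] by auto
    then have "r * ?s \<in> ?K" using sK sf by (simp add: real_subfield_def)
    then show "\<sigma> (p + r * ?s) = p + r * \<sigma> ?s"
      using e pK sK real_embedding_Rats[OF sf e] that by (simp add: real_embedding_def)
    have "\<sigma> (?s * ?s) = \<sigma> ?s * \<sigma> ?s"
      using e sK unfolding real_embedding_def by blast
    moreover have "\<sigma> (?s * ?s) = ?s * ?s"
      using d(1) real_embedding_Rats[OF sf e] by simp
    ultimately show "\<sigma> ?s = ?s \<or> \<sigma> ?s = - ?s"
      using square_eq_iff[of "\<sigma> ?s" ?s] by simp
  qed
  have "\<sigma>\<^sub>1 ?s \<noteq> \<sigma>\<^sub>2 ?s"
  proof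
    assume eq: "\<sigma>\<^sub>1 ?s = \<sigma>\<^sub>2 ?s"
    obtain z where z: "z \<in> ?K" "\<sigma>\<^sub>1 z \<noteq> \<sigma>\<^sub>2 z" using ne by auto
    then obtain p r where "z = p + r * ?s" "p \<in> \<rat>" "r \<in> \<rat>" unfolding K by auto
    then show False using z eq val(1)[OF s(1)] val(1)[OF s(2)] by simp
  qed
  then have "\<bar>\<sigma>\<^sub>1 ?s - \<sigma>\<^sub>2 ?s\<bar> = 2 * ?s"
    using val(2)[OF s(1) pr] val(2)[OF s(2) pr] d(1) by auto
  moreover have "\<sigma>\<^sub>1 (p + r * ?s) - \<sigma>\<^sub>2 (p + r * ?s) = r * (\<sigma>\<^sub>1 ?s - \<sigma>\<^sub>2 ?s)"
    using val(1)[OF s(1) pr] val(1)[OF s(2) pr] by (simp add: algebra_simps)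
  ultimately show ?thesis by (simp add: abs_mult)
qed

theorem proposition3p7:
  fixes d \<nu> :: int and K :: "real set" and \<sigma>\<^sub>1 \<sigma>\<^sub>2 :: "real \<Rightarrow> real" and t q x :: real
  assumes "d \<ge> 2" and "squarefree d"
    and "K = quadratic_field d"
    and "real_embedding K \<sigma>\<^sub>1" and "real_embedding K \<sigma>\<^sub>2" and "\<exists>z\<in>K. \<sigma>\<^sub>1 z \<noteq> \<sigma>\<^sub>2 z"
    and "\<nu> > 0"
    and "t \<in> ring_of_integers K" and "q \<in> ring_of_integers K" and "x \<in> ring_of_integers K"
    and "q\<^sup>2 \<in> \<rat>" and "q = t + of_int \<nu> * x"
    and "\<not> (\<exists>m::int. field_trace K t = of_int m \<and> \<nu> dvd m)"
    and "\<bar>\<sigma>\<^sub>1 t - \<sigma>\<^sub>2 t\<bar> < of_int \<nu> * sqrt (of_int (quadratic_discriminant d))"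
  shows "t \<in> \<int>"
proof -
  note d = assms(1,2) and K = assms(3)
  let ?s = "sqrt (of_int d)"
  note irr = sqrt_squarefree_irrational[OF d]
  have d0: "d \<ge> 0" using d(1) by simp
  note Keq = quadratic_field_eq[OF d0 irr]
  have ss: "?s * ?s = of_int d" using d(1) by simp
  have sf: "real_subfield K" unfolding K Keq by (rule real_subfield_sqrt[OF d0 irr])
  obtain p r where x: "x = p + r * ?s" "p \<in> \<rat>" "r \<in> \<rat>"
    using assms(10) by (auto simp: ring_of_integers_def K Keq)
  obtain p' r' where q: "q = p' + r' * ?s" "p' \<in> \<rat>" "r' \<in> \<rat>"
    using assms(9) by (auto simp: ring_of_integers_def K Keq)
  have t: "t = (p' - of_int \<nu> * p) + (r' - of_int \<nu> * r) * ?s"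
    using assms(12) x q by (simp add: algebra_simps)
  have xi: "algebraic_int (p + r * ?s)" and ti: "algebraic_int t"
    and tK: "t \<in> K"
    using assms(8-10) x by (auto simp: ring_of_integers_def)
  have "q\<^sup>2 = (p'\<^sup>2 + r'\<^sup>2 * of_int d) + 2 * p' * r' * ?s"
    using power2_add_mult_root[OF ss, of p' r'] by (simp add: q(1) power2_eq_square algebra_simps)
  \<comment> \<open>This is the coefficient of the irrational root in the rational number
    \<open>q\<^sup>2\<close>.\<close>
  then have "2 * p' * r' = 0"
    using assms(11) q irrational_coeff_eq_0[OF irr, of "p'\<^sup>2 + r'\<^sup>2 * of_int d" "2 * p' * r'"] by simp
  then consider "r' = 0" | "p' = 0" "r' \<noteq> 0" by auto
  then show ?thesis
  proof cases
    case 1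
    obtain m where m: "2 * r = of_int m"
      using real_quadratic_algebraic_int(2)[OF d x(2,3) xi] by (auto elim: Ints_cases)
    have "\<bar>\<sigma>\<^sub>1 t - \<sigma>\<^sub>2 t\<bar> = of_int \<nu> * (2 * \<bar>r\<bar> * ?s)"
      unfolding t using 1 assms(7) q x
      by (subst real_embedding_diff[OF d0 irr assms(4-6)[unfolded K]]) (auto simp: abs_mult)
    then have lt: "2 * \<bar>r\<bar> * ?s < sqrt (of_int (quadratic_discriminant d))"
      using assms(7,14) by simp
    \<comment> \<open>If the discriminant is \<open>d\<close>, the bound says that the integer
      \<open>2 * r\<close> has absolute value below 1; if it is \<open>4 * d\<close>, the same holds
      for \<open>r\<close>, which is then an integer.\<close>
    have "r = 0"
    proof (cases "[d = 1] (mod 4)")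
      case True
      then have "2 * \<bar>r\<bar> < 1"
        using lt d(1) by (simp add: quadratic_discriminant_def)
      then have "\<bar>m\<bar> < 1" using m by linarith
      then show ?thesis using m by simp
    next
      case False
      then obtain n where n: "r = of_int n"
        using real_quadratic_algebraic_int(3)[OF d x(2,3) xi] by (auto elim: Ints_cases)
      have "\<bar>r\<bar> < 1"
        using lt d(1) False by (simp add: quadratic_discriminant_def real_sqrt_mult)
      then show ?thesis using n by simp
    qed
    then have "t \<in> \<rat>" using 1 t q x by simp
    then show ?thesis using ti rational_algebraic_int_is_int by blast
  next
    case 2
    \<comment> \<open>Here \<open>q\<close> is a multiple of the root, so the rational part of
      \<open>t\<close> comes from \<open>x\<close> alone and \<open>t\<close> has trace
      \<open>- \<nu> * (2 * p)\<close>, with \<open>2 * p\<close> an integer.\<close>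
    define P R where "P = - of_int \<nu> * p" and "R = r' - of_int \<nu> * r"
    have tPR: "t = P + R * ?s" "P \<in> \<rat>" "R \<in> \<rat>"
      using t 2 q x by (auto simp: P_def R_def)
    show ?thesis
    \<comment> \<open>The trace is read off from the quadratic equation only for irrational
      \<open>t\<close>; for rational \<open>t\<close> integrality already gives the claim.\<close>
    proof (cases "t \<in> \<rat>")
      case True
      then show ?thesis using ti rational_algebraic_int_is_int by blast
    next
      case False
      obtain k where k: "2 * p = of_int k"
        using real_quadratic_algebraic_int(1)[OF d x(2,3) xi] by (auto elim: Ints_cases)
      have "of_rat (field_trace K t) = 2 * P"
      proof (rule field_trace_quadratic)
        show "rat_basis K {1, ?s}" unfolding K by (rule rat_basis_sqrt[OF d0 irr])
        show "card {1, ?s} = 2" using irr by (auto simp: card_insert_if)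
        show "t * y \<in> K" if "y \<in> K" for y
          using that tK sf by (simp add: real_subfield_def)
        show "t\<^sup>2 = 2 * P * t - (P\<^sup>2 - R\<^sup>2 * of_int d)"
          unfolding tPR(1) by (rule power2_add_mult_root[OF ss])
      qed (use False tPR in auto)
      also have "\<dots> = of_int (- \<nu> * k)" using k by (simp add: P_def)
      also have "\<dots> = of_rat (of_int (- \<nu> * k))" by (simp only: of_rat_of_int_eq)
      finally have "field_trace K t = of_int (- \<nu> * k)" unfolding of_rat_eq_iff .
      then show ?thesis using assms(13) by (metis dvd_minus_iff dvd_triv_left minus_mult_left)
    qed
  qed
qed

end
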